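(* There are a quasisymmetric map $f:\mathbb{R}\to\mathbb{R}$ and a constant $c>0$ such that $\omega_{f}(Q)\geq c$ for all $Q\in\Delta(\mathbb{R})$ with $\ell(Q)\leq1$.
   Context: A non-constant map $f:\mathbb{R}\to\mathbb{R}$ is quasisymmetric if there is an increasing homeomorphism $\eta:(0,\infty)\to(0,\infty)$ with $\frac{|f(x)-f(y)|}{|f(x)-f(z)|}\leq\eta\left(\frac{|x-y|}{|x-z|}\right)$ for all distinct $x,y,z$. $\Delta(\mathbb{R})$ is the set of dyadic intervals $[2^nj,2^n(j+1)]$, $n,j\in\mathbb{Z}$, and $\ell(Q)$ is the length of $Q$. Define $$\omega_{f}(Q)=\inf_{A}\left(\frac{1}{|Q|}\int_{Q}\left(\frac{|f-A|}{|A'|\operatorname{diam}Q}\right)^{2}\right)^{1/2},$$ the infimum being over affine maps $A:\mathbb{R}\to\mathbb{R}$ with nonzero slope $A'$. *)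

theory Defs
  imports "HOL-Analysis.Analysis"
begin

(* The quotient presupposes f x \<noteq> f z; this is required explicitly, because division
   by zero yields zero in HOL. *)
definition quasisymmetric :: "(real \<Rightarrow> real) \<Rightarrow> bool" where
  "quasisymmetric f \<longleftrightarrow>
     \<not> f constant_on UNIV \<and>
     (\<exists>\<eta> \<theta> :: real \<Rightarrow> real.
        homeomorphism {0<..} {0<..} \<eta> \<theta> \<and> strict_mono_on {0<..} \<eta> \<and>
        (\<forall>x y z. x \<noteq> y \<and> x \<noteq> z \<and> y \<noteq> z \<longrightarrow>
           f x \<noteq> f z \<and>
           \<bar>f x - f y\<bar> / \<bar>f x - f z\<bar> \<le> \<eta> (\<bar>x - y\<bar> / \<bar>x - z\<bar>)))"

definition dyadic_intervals :: "real set set" where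
  "dyadic_intervals =
     {{2 powi n * of_int j .. 2 powi n * (of_int j + 1)} | n j :: int. True}"

(* The affine map is A x = a * x + b, so that A' = a. The integrand is continuous whenever
   f is quasisymmetric, hence the Bochner integral then has its classical value. *)
definition omega :: "(real \<Rightarrow> real) \<Rightarrow> real set \<Rightarrow> real" where
  "omega f Q =
     (INF (a, b) \<in> {a. a \<noteq> 0} \<times> UNIV.
        sqrt (1 / measure lborel Q *
          (LINT x:Q|lborel. (\<bar>f x - (a * x + b)\<bar> / (\<bar>a\<bar> * diameter Q))\<^sup>2)))"

end

theory Submission
  imports Defs
begin

text \<open>
  The map is the cumulative distribution function of a self-similar measure on the line whose
  mass on every dyadic interval of length at most one is divided between the two halves in the
  proportion \<open>1 : 2\<close> or \<open>2 : 1\<close>. Such a measure is never close to a multiple of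
  Lebesgue measure on any such interval, at any scale, and this keeps \<^const>\<open>omega\<close> away
  from zero.

  What has to be arranged is quasisymmetry. If the light half were always on the left, the
  masses just to the left and just to the right of a dyadic point would drift apart geometrically
  under refinement. Here the light half is on the left for intervals of even index and on the
  right for those of odd index, so that the halves meeting at a common endpoint of two
  neighbours always have the same weight: refinement preserves the ratio of their masses, and
  neighbours of equal length never differ by a factor of more than two (\<open>mass_adjacent\<close>).
  Hence increments of the distribution function over adjacent intervals of equal length are
  comparable, and an increasing function with that doubling property is quasisymmetric
  (\<open>doubling_imp_quasisymmetric\<close>).

  For the lower bound, divide a dyadic interval into quarters. One quarter receives \<open>1/9\<close>
  of the mass and one of the two middle quarters \<open>4/9\<close>. An affine map has the same increment
  over both, so a monotone function with these increments cannot be near it simultaneously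
  around the four endpoints of the two quarters. The function therefore stays at a definite
  distance from the affine map on an interval of length comparable to the whole
  (\<open>monotone_far_from_affine\<close>), which bounds the mean square deviation from below
  (\<open>omega_lower_bound\<close>).
\<close>

section \<open>Doubling and quasisymmetry\<close>

lemma dyadic_bracket:
  fixes t :: real
  assumes "t \<ge> 1"
  shows "\<exists>k::nat. 2 ^ k \<le> t \<and> t < 2 ^ Suc k"
proof -
  define k where "k = nat \<lfloor>log 2 t\<rfloor>"
  have "log 2 t \<ge> 0" using assms by simp
  then have "real k \<le> log 2 t" "log 2 t < real k + 1"
    unfolding k_def by linarith+
  then have "2 powr real k \<le> t" "t < 2 powr real (Suc k)"
    using assms by (simp_all add: le_log_iff log_less_iff add.commute)
  then show ?thesis by (metis powr_realpow zero_less_numeral)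
qed

text \<open>
  Doubling the radius \<open>k\<close> times multiplies \<open>w\<close> by a factor between \<open>A ^ k\<close> and
  \<open>B ^ k\<close>, and these are powers of \<open>2 ^ k\<close> with exponents \<open>log 2 A\<close> and
  \<open>log 2 B\<close>. The first governs \<open>t < 1\<close>, the second \<open>t \<ge> 1\<close>; adding both gives a
  single increasing gauge. The argument is \<open>2 * t\<close> because \<open>t\<close> is rounded to a
  power of two.
\<close>

lemma power_growth_from_doubling:
  fixes w :: "real \<Rightarrow> real" and A B :: real
  assumes mono: "\<And>r s. 0 < r \<Longrightarrow> r \<le> s \<Longrightarrow> w r \<le> w s"
    and pos: "\<And>r. 0 < r \<Longrightarrow> 0 < w r"
    and A: "A > 1" "\<And>r. 0 < r \<Longrightarrow> A * w r \<le> w (2 * r)"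
    and B: "B > 1" "\<And>r. 0 < r \<Longrightarrow> w (2 * r) \<le> B * w r"
    and r: "0 < r" and t: "0 < t"
  shows "w (t * r) \<le> ((2 * t) powr log 2 A + (2 * t) powr log 2 B) * w r"
proof -
  have up: "w (2 ^ k * r) \<le> B ^ k * w r" for k :: nat
  proof (induction k)
    case (Suc k)
    have "w (2 ^ Suc k * r) \<le> B * w (2 ^ k * r)"
      using B(2)[of "2 ^ k * r"] r by (simp add: mult.assoc)
    also have "\<dots> \<le> B * (B ^ k * w r)" using Suc B(1) by simp
    finally show ?case by (simp add: mult.assoc)
  qed simp
  have down: "A ^ k * w s \<le> w (2 ^ k * s)" if "0 < s" for k :: nat and s
  proof (induction k)
    case (Suc k)
    have "A * (A ^ k * w s) \<le> A * w (2 ^ k * s)" using Suc A(1) by simp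
    also have "\<dots> \<le> w (2 ^ Suc k * s)"
      using A(2)[of "2 ^ k * s"] that by (simp add: mult.assoc)
    finally show ?case by (simp add: mult.assoc)
  qed simp
  have pw: "(2 ^ k) powr log 2 C = C ^ k" if "C > 1" for C :: real and k :: nat
  proof -
    have "(2 ^ k) powr log 2 C = (2 powr log 2 C) powr real k"
      by (simp add: powr_powr powr_realpow[symmetric] mult.commute)
    also have "\<dots> = C ^ k" using that by (simp add: powr_realpow)
    finally show ?thesis .
  qed
  show ?thesis
  proof (cases "t \<ge> 1")
    case True
    then obtain k :: nat where k: "2 ^ k \<le> t" "t < 2 ^ Suc k" using dyadic_bracket by blast
    have "w (t * r) \<le> w (2 ^ Suc k * r)"
      using k r t by (intro mono) (auto intro!: mult_right_mono)
    also have "\<dots> \<le> B ^ Suc k * w r" by (rule up)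
    also have "B ^ Suc k = (2 ^ Suc k) powr log 2 B" by (rule pw[OF B(1), symmetric])
    also have "\<dots> \<le> (2 * t) powr log 2 B" using k B(1) by (intro powr_mono2) auto
    finally have "w (t * r) \<le> (2 * t) powr log 2 B * w r" using pos[OF r] by simp
    moreover have "0 \<le> (2 * t) powr log 2 A * w r" using pos[OF r] by simp
    ultimately show ?thesis by (simp add: distrib_right)
  next
    case False
    then have "1 / t \<ge> 1" using t by simp
    then obtain k :: nat where k: "2 ^ k \<le> 1 / t" "1 / t < 2 ^ Suc k" using dyadic_bracket by blast
    then have kt: "2 ^ k * t \<le> 1" "1 \<le> 2 ^ k * (2 * t)" using t by (auto simp: field_simps)
    have "A ^ k * w (t * r) \<le> w (2 ^ k * (t * r))" using r t by (intro down) simp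
    also have "\<dots> \<le> w r"
      using kt r t by (intro mono) (auto simp: mult.assoc[symmetric] intro: mult_left_le_one_le)
    finally have *: "A ^ k * w (t * r) \<le> w r" .
    have "1 \<le> (2 ^ k * (2 * t)) powr log 2 A" using kt A(1) by (intro ge_one_powr_ge_zero) auto
    also have "\<dots> = A ^ k * (2 * t) powr log 2 A"
      using t pw[OF A(1)] by (simp add: powr_mult)
    finally have "w (t * r) \<le> (A ^ k * (2 * t) powr log 2 A) * w (t * r)"
      using pos[of "t * r"] r t by simp
    also have "\<dots> = (2 * t) powr log 2 A * (A ^ k * w (t * r))" by simp
    also have "\<dots> \<le> (2 * t) powr log 2 A * w r" using * by (intro mult_left_mono) auto
    finally have "w (t * r) \<le> (2 * t) powr log 2 A * w r" .
    moreover have "0 \<le> (2 * t) powr log 2 B * w r" using pos[OF r] by simp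
    ultimately show ?thesis by (simp add: distrib_right)
  qed
qed

text \<open>The gauge functions produced by the preceding lemma qualify as \<open>\<eta>\<close> in the definition of
  \<^const>\<open>quasisymmetric\<close>.\<close>

lemma sum_of_powers_homeomorphism:
  fixes \<alpha> \<beta> K :: real
  assumes "\<alpha> > 0" "\<beta> > 0" "K > 0"
  defines "\<eta> \<equiv> \<lambda>t. K * ((2 * t) powr \<alpha> + (2 * t) powr \<beta>)"
  shows "strict_mono_on {0<..} \<eta>" and "\<exists>\<theta>. homeomorphism {0<..} {0<..} \<eta> \<theta>"
proof -
  show sm: "strict_mono_on {0<..} \<eta>"
    using assms by (auto simp: strict_mono_on_def intro!: add_strict_mono powr_less_mono2)
  have cont: "continuous_on {0<..} \<eta>"
    unfolding \<eta>_def by (intro continuous_intros) auto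
  have "\<eta> ` {0<..} = {0<..}"
  proof (intro equalityI subsetI)
    fix y assume "y \<in> \<eta> ` {0<..}"
    then show "y \<in> {0<..}" using assms by (auto simp: \<eta>_def intro!: mult_pos_pos add_pos_pos)
  next
    fix y :: real assume y: "y \<in> {0<..}"
    \<comment> \<open>At \<open>u\<close> and \<open>v\<close> one of the two summands contributes exactly \<open>y / 2\<close>, so the value
      \<open>y\<close> is attained between them.\<close>
    define u where "u = (y / (2 * K)) powr (1 / \<alpha>) / 2"
    define v where "v = (y / (2 * K)) powr (1 / \<beta>) / 2"
    have uv: "u > 0" "v > 0" "(2 * u) powr \<alpha> = y / (2 * K)" "(2 * v) powr \<beta> = y / (2 * K)"
      using y assms by (auto simp: u_def v_def powr_powr)
    have "(2 * min u v) powr \<alpha> \<le> y / (2 * K)"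
      using uv assms powr_mono2[of \<alpha> "2 * min u v" "2 * u"] by auto
    moreover have "(2 * min u v) powr \<beta> \<le> y / (2 * K)"
      using uv assms powr_mono2[of \<beta> "2 * min u v" "2 * v"] by auto
    ultimately have "K * ((2 * min u v) powr \<alpha> + (2 * min u v) powr \<beta>) \<le> K * (y / (2 * K) + y / (2 * K))"
      using assms by (intro mult_left_mono add_mono) auto
    then have lo: "\<eta> (min u v) \<le> y" using assms by (simp add: \<eta>_def)
    have "y / (2 * K) \<le> (2 * max u v) powr \<alpha>"
      using uv assms powr_mono2[of \<alpha> "2 * u" "2 * max u v"] by auto
    moreover have "y / (2 * K) \<le> (2 * max u v) powr \<beta>"
      using uv assms powr_mono2[of \<beta> "2 * v" "2 * max u v"] by auto
    ultimately have "K * (y / (2 * K) + y / (2 * K)) \<le> K * ((2 * max u v) powr \<alpha> + (2 * max u v) powr \<beta>)"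
      using assms by (intro mult_left_mono add_mono) auto
    then have hi: "y \<le> \<eta> (max u v)" using assms by (simp add: \<eta>_def)
    have "continuous_on {min u v..max u v} \<eta>"
      using uv by (intro continuous_on_subset[OF cont]) auto
    then obtain x where "min u v \<le> x" "\<eta> x = y"
      using IVT'[of \<eta>, OF lo hi] uv by fastforce
    then show "y \<in> \<eta> ` {0<..}" using uv by (intro image_eqI[of _ _ x]) auto
  qed
  then show "\<exists>\<theta>. homeomorphism {0<..} {0<..} \<eta> \<theta>"
    using invariance_of_domain_homeomorphism[of "{0<..}" \<eta>] cont
      strict_mono_on_imp_inj_on[OF sm] by (metis DIM_real open_greaterThan order_refl)
qed

text \<open>
  The symmetric increment \<open>f (x + r) - f (x - r)\<close> is at most \<open>1 + M\<close> times either of its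
  one-sided parts, so one gauge controls both the case where \<open>y\<close> and \<open>z\<close> lie on the same
  side of \<open>x\<close> and the case where they do not. Bounding the increment over \<open>[x + a, x + 2 * a]\<close>
  by \<open>M\<close> times that over \<open>[x, x + a]\<close> limits the growth of the symmetric increment from above; the
  reverse bound forces it to grow, which is what makes the gauge tend to zero.
\<close>

lemma doubling_imp_quasisymmetric:
  fixes f :: "real \<Rightarrow> real" and M :: real
  assumes sm: "strict_mono f" and M: "M > 0"
    and right: "\<And>x h. 0 < h \<Longrightarrow> f (x + h) - f x \<le> M * (f x - f (x - h))"
    and left: "\<And>x h. 0 < h \<Longrightarrow> f x - f (x - h) \<le> M * (f (x + h) - f x)"
  shows "quasisymmetric f"
proof -
  define \<eta> where "\<eta> = (\<lambda>t. (1 + M) * ((2 * t) powr log 2 (1 + 1 / M) + (2 * t) powr log 2 (1 + M)))"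
  have A: "1 + 1 / M > 1" and B: "1 + M > 1" using M by auto
  have \<eta>: "strict_mono_on {0<..} \<eta>" "\<exists>\<theta>. homeomorphism {0<..} {0<..} \<eta> \<theta>"
    unfolding \<eta>_def
    using sum_of_powers_homeomorphism[of "log 2 (1 + 1 / M)" "log 2 (1 + M)" "1 + M"] A B
    by simp_all
  have bound: "\<bar>f x - f y\<bar> / \<bar>f x - f z\<bar> \<le> \<eta> (\<bar>x - y\<bar> / \<bar>x - z\<bar>)"
    if "x \<noteq> y" "x \<noteq> z" for x y z
  proof -
    define w where "w = (\<lambda>r. f (x + r) - f (x - r))"
    define r where "r = \<bar>x - z\<bar>"
    define s where "s = \<bar>x - y\<bar>"
    have rs: "r > 0" "s > 0" using that by (auto simp: r_def s_def)
    have less: "f u < f v" if "u < v" for u v using sm that by (simp add: strict_mono_less)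
    have le: "f u \<le> f v" if "u \<le> v" for u v using sm that by (simp add: strict_mono_less_eq)
    have "w (s / r * r) \<le> ((2 * (s / r)) powr log 2 (1 + 1 / M) + (2 * (s / r)) powr log 2 (1 + M)) * w r"
    proof (rule power_growth_from_doubling)
      show "w a \<le> w b" if "0 < a" "a \<le> b" for a b
        using le[of "x + a" "x + b"] le[of "x - b" "x - a"] that by (simp add: w_def)
      show "0 < w a" if "0 < a" for a
        using less[of "x - a" "x + a"] that by (simp add: w_def)
      fix a :: real assume a: "0 < a"
      have 1: "f (x + 2 * a) - f (x + a) \<le> M * (f (x + a) - f x)"
        using right[of a "x + a"] a by (simp add: algebra_simps)
      have 2: "f (x - a) - f (x - 2 * a) \<le> M * (f x - f (x - a))"
        using left[of a "x - a"] a by (simp add: algebra_simps)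
      have 3: "f (x + a) - f x \<le> M * (f (x + 2 * a) - f (x + a))"
        using left[of a "x + a"] a by (simp add: algebra_simps)
      have 4: "f x - f (x - a) \<le> M * (f (x - a) - f (x - 2 * a))"
        using right[of a "x - a"] a by (simp add: algebra_simps)
      show "w (2 * a) \<le> (1 + M) * w a"
        using 1 2 by (simp add: w_def algebra_simps)
      have "w a \<le> M * (w (2 * a) - w a)"
        using 3 4 by (simp add: w_def algebra_simps)
      then show "(1 + 1 / M) * w a \<le> w (2 * a)"
        using M by (simp add: field_simps)
    qed (use A B rs in auto)
    then have "(1 + M) * w s \<le> \<eta> (s / r) * w r"
      using rs M by (simp add: \<eta>_def mult.assoc)
    moreover have "\<bar>f x - f y\<bar> \<le> w s"
    proof (cases "x < y")
      case True
      then show ?thesis using less[of x y] less[of "x - s" x] rs by (simp add: w_def s_def)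
    next
      case False
      then show ?thesis using less[of y x] less[of x "x + s"] rs that by (simp add: w_def s_def)
    qed
    moreover have "w r \<le> (1 + M) * \<bar>f x - f z\<bar>"
    proof (cases "x < z")
      case True
      then show ?thesis using less[of x z] left[OF rs(1), of x] by (simp add: w_def r_def algebra_simps)
    next
      case False
      then show ?thesis using less[of z x] right[OF rs(1), of x] that
        by (simp add: w_def r_def algebra_simps)
    qed
    moreover have \<eta>0: "\<eta> (s / r) \<ge> 0" using M by (simp add: \<eta>_def)
    ultimately have "(1 + M) * \<bar>f x - f y\<bar> \<le> \<eta> (s / r) * ((1 + M) * \<bar>f x - f z\<bar>)"
      using M by (meson mult_left_mono order_trans less_imp_le B zero_less_one)
    then have "(1 + M) * \<bar>f x - f y\<bar> \<le> (1 + M) * (\<eta> (s / r) * \<bar>f x - f z\<bar>)"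
      by (simp add: mult.left_commute)
    then have "\<bar>f x - f y\<bar> \<le> \<eta> (s / r) * \<bar>f x - f z\<bar>"
      using M by simp
    moreover have "\<bar>f x - f z\<bar> > 0" using sm that by (simp add: strict_mono_eq)
    ultimately show ?thesis by (simp add: s_def r_def divide_le_eq)
  qed
  have "\<not> f constant_on UNIV"
    using sm strict_monoD[OF sm, of 0 1] unfolding constant_on_def by fastforce
  then show ?thesis
    unfolding quasisymmetric_def using \<eta> bound sm by (metis strict_mono_eq)
qed

section \<open>Monotone functions far from affine maps\<close>

text \<open>
  Otherwise, in each of the four intervals there is a point where \<open>f\<close> is close to the affine map.
  The points in the first two intervals lie inside \<open>[s, s + d]\<close> at distance at least
  \<open>d / 2\<close>, so the increment there is at least about \<open>a * d / 2\<close>; the other two enclose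
  \<open>[s', s' + d]\<close> at distance at most \<open>3 * d / 2\<close>, so the increment there is at most about
  \<open>3 * a * d / 2\<close>. Up to the errors the ratio of the increments is thus at most three, against
  the assumed four. With errors of \<open>e * \<bar>a\<bar> * d\<close>, each increment is off by at most twice that, and the contradiction needs
  \<open>4 * (1 / 2 - 2 * e) > 3 / 2 + 2 * e\<close>, that is \<open>e < 1 / 20\<close>; \<open>1 / 25\<close> satisfies this.
  A negative slope is excluded by the first two points alone, since \<open>f\<close> increases.
\<close>

lemma monotone_far_from_affine:
  fixes f :: "real \<Rightarrow> real"
  assumes f: "mono f" and d: "d > 0" and a: "a \<noteq> 0"
    and ratio: "4 * (f (s + d) - f s) \<le> f (s' + d) - f s'"
  shows "\<exists>u \<in> {s, s + 3 * d / 4, s' - d / 4, s' + d}.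
           \<forall>x \<in> {u..u + d / 4}. \<bar>a\<bar> * d / 25 \<le> \<bar>f x - (a * x + b)\<bar>"
proof (rule ccontr)
  assume "\<not> ?thesis"
  then obtain t0 t1 t2 t3 where
    t: "s \<le> t0" "t0 \<le> s + d / 4" "s + 3 * d / 4 \<le> t1" "t1 \<le> s + 3 * d / 4 + d / 4"
      "s' - d / 4 \<le> t2" "t2 \<le> s' - d / 4 + d / 4" "s' + d \<le> t3" "t3 \<le> s' + d + d / 4"
    and e: "\<bar>f t0 - (a * t0 + b)\<bar> < \<bar>a\<bar> * d / 25" "\<bar>f t1 - (a * t1 + b)\<bar> < \<bar>a\<bar> * d / 25"
      "\<bar>f t2 - (a * t2 + b)\<bar> < \<bar>a\<bar> * d / 25" "\<bar>f t3 - (a * t3 + b)\<bar> < \<bar>a\<bar> * d / 25"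
    by (auto simp: not_le)
  have f': "f t0 \<le> f t1" "f s \<le> f t0" "f t1 \<le> f (s + d)" "f t2 \<le> f s'" "f (s' + d) \<le> f t3"
    using t d by (auto intro!: monoD[OF f])
  show False
  proof (cases "a > 0")
    case True
    have "a * (d / 2) \<le> a * (t1 - t0)" "a * (t3 - t2) \<le> a * (3 * d / 2)"
      using t True by (auto intro!: mult_left_mono)
    moreover have "0 < a * d" using True d by simp
    ultimately show False
      using e f' ratio unfolding abs_of_pos[OF True] abs_less_iff by (simp add: algebra_simps)
  next
    case False
    then have "a < 0" using a by simp
    then have "a * (t1 - t0) \<le> a * (d / 2)"
      using t by (intro mult_left_mono_neg) auto
    moreover have "a * d < 0" using \<open>a < 0\<close> d by (simp add: mult_neg_pos)
    ultimately show False
      using e f' unfolding abs_of_neg[OF \<open>a < 0\<close>] abs_less_iff by (simp add: algebra_simps)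
  qed
qed

text \<open>
  The interval consists of four pieces of length \<open>d\<close>, so the deviation \<open>\<bar>a\<bar> * d / 25\<close>
  is \<open>1 / 100\<close> after normalization, and it occurs on a sixteenth of the interval:
  \<open>sqrt (1 / 16) * (1 / 100) = 1 / 400\<close>. The hypothesis on \<open>s'\<close> leaves room of a quarter
  piece on both sides, where the deviation may occur.
\<close>

lemma omega_lower_bound:
  fixes f :: "real \<Rightarrow> real"
  assumes f: "mono f" and d: "d > 0"
    and s: "l \<le> s" "s + d \<le> l + 4 * d"
    and s': "l + d / 4 \<le> s'" "s' + d + d / 4 \<le> l + 4 * d"
    and ratio: "4 * (f (s + d) - f s) \<le> f (s' + d) - f s'"
  shows "omega f {l..l + 4 * d} \<ge> 1 / 400"
  unfolding omega_def
proof (rule cINF_greatest, simp, use zero_neq_one in blast, clarify)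
  fix a b :: real assume a: "a \<noteq> 0"
  let ?Q = "{l..l + 4 * d}"
  define g where "g x = (\<bar>f x - (a * x + b)\<bar> / (\<bar>a\<bar> * diameter ?Q))\<^sup>2" for x
  have diam: "diameter ?Q = 4 * d" using d by (simp add: diameter_closed_interval)
  obtain u where u: "u \<in> {s, s + 3 * d / 4, s' - d / 4, s' + d}"
    and far: "\<And>x. x \<in> {u..u + d / 4} \<Longrightarrow> \<bar>a\<bar> * d / 25 \<le> \<bar>f x - (a * x + b)\<bar>"
    using monotone_far_from_affine[OF f d a ratio] by blast
  have sub: "{u..u + d / 4} \<subseteq> ?Q" using u s s' d by auto
  have g_lower: "1 / 10000 \<le> g x" if "x \<in> {u..u + d / 4}" for x
  proof -
    have "1 / 100 \<le> \<bar>f x - (a * x + b)\<bar> / (\<bar>a\<bar> * (4 * d))"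
      using far[OF that] a d by (simp add: field_simps)
    then have "(1 / 100)\<^sup>2 \<le> g x"
      unfolding g_def diam by (intro power_mono) auto
    then show ?thesis by (simp add: power2_eq_square)
  qed
  have [measurable]: "f \<in> borel_measurable borel" using f by (rule borel_measurable_mono)
  have int_g: "set_integrable lborel ?Q g"
    unfolding set_integrable_def
  proof (rule integrableI_bounded_set_indicator)
    define B where "B = \<bar>f l\<bar> + \<bar>f (l + 4 * d)\<bar> + \<bar>a\<bar> * (\<bar>l\<bar> + 4 * d) + \<bar>b\<bar>"
    show "AE x in lborel. x \<in> ?Q \<longrightarrow> norm (g x) \<le> (B / (\<bar>a\<bar> * diameter ?Q))\<^sup>2"
    proof (intro AE_I2 impI)
      fix x assume x: "x \<in> ?Q"
      have "f l \<le> f x" "f x \<le> f (l + 4 * d)" using x by (auto intro!: monoD[OF f])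
      moreover have "\<bar>a * x\<bar> \<le> \<bar>a\<bar> * (\<bar>l\<bar> + 4 * d)"
        unfolding abs_mult using x d by (intro mult_left_mono) auto
      ultimately have "\<bar>f x - (a * x + b)\<bar> \<le> B" unfolding B_def by linarith
      then show "norm (g x) \<le> (B / (\<bar>a\<bar> * diameter ?Q))\<^sup>2"
        unfolding g_def diam using d a
        by (auto intro!: power_mono divide_right_mono)
    qed
  qed (use d in \<open>auto simp: g_def emeasure_lborel_Icc_eq\<close>)
  have "d / 4 * (1 / 10000) = (LINT x:{u..u + d / 4}|lborel. 1 / 10000)"
    using d by (simp add: set_lebesgue_integral_def)
  also have "\<dots> \<le> (LINT x:?Q|lborel. g x)"
    unfolding set_lebesgue_integral_def
  proof (rule integral_mono)
    show "integrable lborel (\<lambda>x. indicator {u..u + d / 4} x *\<^sub>R (1 / 10000 :: real))"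
      using d by (simp add: emeasure_lborel_Icc_eq)
    show "integrable lborel (\<lambda>x. indicator ?Q x *\<^sub>R g x)"
      using int_g unfolding set_integrable_def .
    show "indicator {u..u + d / 4} x *\<^sub>R (1 / 10000) \<le> indicator ?Q x *\<^sub>R g x" for x
      using g_lower[of x] sub by (auto simp: indicator_def g_def)
  qed
  finally have "(1 / 400)\<^sup>2 \<le> 1 / measure lborel ?Q * (LINT x:?Q|lborel. g x)"
    using d by (simp add: field_simps power2_eq_square)
  then show "1 / 400 \<le> sqrt (1 / measure lborel ?Q *
      (LINT x:?Q|lborel. (\<bar>f x - (a * x + b)\<bar> / (\<bar>a\<bar> * diameter ?Q))\<^sup>2))"
    unfolding g_def by (rule real_le_rsqrt)
qed

section \<open>A singular function with doubling increments\<close>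

text \<open>
  The mass of \<open>[k / 2 ^ n, (k + 1) / 2 ^ n]\<close>. The parities of \<open>k\<close> and \<open>k div 2\<close> are the last
  two binary digits, so their sum is the last digit of the Gray code of \<open>k\<close>. On the unit interval
  the resulting distribution function is the conjugacy between the tent map and the skew tent map
  with peak at \<open>1 / 3\<close>.
\<close>

primrec mass :: "nat \<Rightarrow> int \<Rightarrow> real" where
  "mass 0 k = 1"
| "mass (Suc n) k = mass n (k div 2) * (if even (k + k div 2) then 1 / 3 else 2 / 3)"

text \<open>The distribution function at the point \<open>k / 2 ^ n\<close>, normalized to vanish at zero.\<close>

primrec cumul :: "nat \<Rightarrow> int \<Rightarrow> real" where
  "cumul 0 k = of_int k"
| "cumul (Suc n) k = cumul n (k div 2) + (if odd k then mass (Suc n) (k - 1) else 0)"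

definition singular_map :: "real \<Rightarrow> real" where
  "singular_map x = lim (\<lambda>n. cumul n \<lfloor>2 ^ n * x\<rfloor>)"

lemma mass_pos: "mass n k > 0"
  by (induction n arbitrary: k) auto

lemma cumul_succ: "cumul n (k + 1) = cumul n k + mass n k"
proof (induction n arbitrary: k)
  case (Suc n)
  show ?case
  proof (cases "even k")
    case True
    then show ?thesis by (auto elim!: evenE)
  next
    case False
    then obtain i where "k = 2 * i + 1" by (auto elim: oddE)
    moreover have "(2 * i + 2) div 2 = i + 1" for i :: int by simp
    ultimately show ?thesis using Suc[of i] by (simp add: algebra_simps)
  qed
qed simp

lemma cumul_mono: "i \<le> j \<Longrightarrow> cumul n i \<le> cumul n j"
proof (induction j rule: int_ge_induct)
  case (step j)
  then show ?case using mass_pos[of n j] by (simp add: cumul_succ)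
qed simp

lemma cumul_refine: "cumul (n + i) (2 ^ i * k) = cumul n k"
  by (induction i) (simp_all add: mult.assoc)

text \<open>
  Siblings have ratio \<open>1 : 2\<close> or \<open>2 : 1\<close>. Neighbours with different parents are the odd child of
  \<open>i\<close> and the even child of \<open>i + 1\<close>; their weights are decided by the parities of
  \<open>2 * i + 1 + i\<close> and \<open>2 * i + 2 + (i + 1)\<close>, which agree, so they inherit the ratio of the parents.
\<close>

lemma mass_adjacent: "mass n (k + 1) \<le> 2 * mass n k \<and> mass n k \<le> 2 * mass n (k + 1)"
proof (induction n arbitrary: k)
  case (Suc n)
  show ?case
  proof (cases "even k")
    case True
    then show ?thesis using mass_pos[of n "k div 2"] by (auto elim!: evenE)
  next
    case False
    then obtain i where "k = 2 * i + 1" by (auto elim: oddE)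
    moreover have "(2 * i + 2) div 2 = i + 1" for i :: int by simp
    ultimately show ?thesis using Suc[of i] by (simp add: algebra_simps)
  qed
qed simp

text \<open>
  The approximations from the left endpoints increase with the level and are bounded by the value at
  any right endpoint, which gives convergence.
\<close>

lemma cumul_floor_refine:
  "cumul n \<lfloor>2 ^ n * x\<rfloor> \<le> cumul (n + i) \<lfloor>2 ^ (n + i) * x\<rfloor>"
  "cumul (n + i) \<lfloor>2 ^ (n + i) * x\<rfloor> \<le> cumul n (\<lfloor>2 ^ n * x\<rfloor> + 1)"
proof -
  have eq: "2 ^ (n + i) * x = 2 ^ i * (2 ^ n * x)" by (simp add: power_add)
  have "2 ^ i * of_int \<lfloor>2 ^ n * x\<rfloor> \<le> 2 ^ (n + i) * x"
    unfolding eq by (intro mult_left_mono) auto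
  then have "2 ^ i * \<lfloor>2 ^ n * x\<rfloor> \<le> \<lfloor>2 ^ (n + i) * x\<rfloor>"
    by (simp add: le_floor_iff)
  then show "cumul n \<lfloor>2 ^ n * x\<rfloor> \<le> cumul (n + i) \<lfloor>2 ^ (n + i) * x\<rfloor>"
    by (metis cumul_mono cumul_refine)
  have "2 ^ (n + i) * x \<le> 2 ^ i * (of_int \<lfloor>2 ^ n * x\<rfloor> + 1)"
    unfolding eq by (intro mult_left_mono) (auto, linarith)
  then have "\<lfloor>2 ^ (n + i) * x\<rfloor> \<le> 2 ^ i * (\<lfloor>2 ^ n * x\<rfloor> + 1)"
    by (simp add: floor_le_iff)
  then show "cumul (n + i) \<lfloor>2 ^ (n + i) * x\<rfloor> \<le> cumul n (\<lfloor>2 ^ n * x\<rfloor> + 1)"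
    by (metis cumul_mono cumul_refine)
qed

lemma cumul_tendsto_singular_map: "(\<lambda>n. cumul n \<lfloor>2 ^ n * x\<rfloor>) \<longlonglongrightarrow> singular_map x"
proof -
  have "incseq (\<lambda>n. cumul n \<lfloor>2 ^ n * x\<rfloor>)"
    using cumul_floor_refine(1)[of _ x 1] by (intro incseq_SucI) simp
  moreover have "cumul n \<lfloor>2 ^ n * x\<rfloor> \<le> cumul 0 (\<lfloor>x\<rfloor> + 1)" for n
    using cumul_floor_refine(2)[of 0 n x] by simp
  ultimately obtain L where "(\<lambda>n. cumul n \<lfloor>2 ^ n * x\<rfloor>) \<longlonglongrightarrow> L"
    using incseq_convergent by blast
  then have "convergent (\<lambda>n. cumul n \<lfloor>2 ^ n * x\<rfloor>)" by (rule convergentI)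
  then show ?thesis unfolding singular_map_def by (simp add: convergent_LIMSEQ_iff)
qed

lemma mono_singular_map: "mono singular_map"
proof (rule monoI)
  fix x y :: real assume "x \<le> y"
  then have "cumul n \<lfloor>2 ^ n * x\<rfloor> \<le> cumul n \<lfloor>2 ^ n * y\<rfloor>" for n
    by (intro cumul_mono floor_mono mult_left_mono) auto
  then show "singular_map x \<le> singular_map y"
    by (intro LIMSEQ_le[OF cumul_tendsto_singular_map cumul_tendsto_singular_map]) auto
qed

lemma singular_map_dyadic: "singular_map (of_int k / 2 ^ n) = cumul n k"
proof -
  have "\<lfloor>2 ^ (i + n) * (of_int k / 2 ^ n :: real)\<rfloor> = 2 ^ i * k" for i
  proof -
    have "2 ^ (i + n) * (of_int k / 2 ^ n :: real) = of_int (2 ^ i * k)"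
      by (simp add: power_add)
    then show ?thesis by (simp only: floor_of_int)
  qed
  then have "cumul (i + n) \<lfloor>2 ^ (i + n) * (of_int k / 2 ^ n :: real)\<rfloor> = cumul n k" for i
    using cumul_refine[of n i k] by (simp add: add.commute)
  then show ?thesis
    using LIMSEQ_ignore_initial_segment[OF cumul_tendsto_singular_map, of n "of_int k / 2 ^ n"]
    by (simp only: LIMSEQ_const_iff)
qed

text \<open>
  For \<open>h \<le> 4\<close> choose the level with \<open>2 < 2 ^ n * h \<le> 4\<close>. Each of \<open>[x, x + h]\<close> and
  \<open>[x - h, x]\<close> then contains the dyadic neighbour on its side of the interval around \<open>x\<close>, hence
  at least half the mass of that interval, and is covered by five dyadic intervals, whose total mass is
  at most \<open>1 + 2 + 4 + 8 + 16 = 31\<close> times that mass. For larger \<open>h\<close> the map is within one of the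
  identity, and the increments lie between \<open>h / 2\<close> and \<open>3 * h / 2\<close>.
\<close>

lemma singular_map_increments_comparable:
  assumes h: "h > 0"
  shows "\<exists>\<mu> > 0. singular_map (x + h) - singular_map x \<in> {\<mu>..62 * \<mu>} \<and>
                 singular_map x - singular_map (x - h) \<in> {\<mu>..62 * \<mu>}"
proof (cases "h \<le> 4")
  case True
  then have "4 / h \<ge> 1" using h by simp
  then obtain n :: nat where n: "2 ^ n \<le> 4 / h" "4 / h < 2 ^ Suc n" using dyadic_bracket by blast
  define k where "k = \<lfloor>2 ^ n * x\<rfloor>"
  have hn: "2 ^ n * h \<le> 4" "2 < 2 ^ n * h" using n h by (auto simp: field_simps)
  have k: "of_int k \<le> 2 ^ n * x" "2 ^ n * x < of_int k + 1" unfolding k_def by linarith+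
  have le: "cumul n i \<le> singular_map y" if "of_int i \<le> 2 ^ n * y" for i y
    unfolding singular_map_dyadic[symmetric]
    using that by (intro monoD[OF mono_singular_map]) (simp add: divide_le_eq mult.commute)
  have ge: "singular_map y \<le> cumul n i" if "2 ^ n * y \<le> of_int i" for i y
    unfolding singular_map_dyadic[symmetric]
    using that by (intro monoD[OF mono_singular_map]) (simp add: le_divide_eq mult.commute)
  have "2 ^ n * (x + h) = 2 ^ n * x + 2 ^ n * h" "2 ^ n * (x - h) = 2 ^ n * x - 2 ^ n * h"
    by (simp_all add: algebra_simps)
  then have up: "cumul n (k + 2) \<le> singular_map (x + h)" "singular_map (x + h) \<le> cumul n (k + 5)"
    "cumul n k \<le> singular_map x" "singular_map x \<le> cumul n (k + 1)"
    "cumul n (k - 4) \<le> singular_map (x - h)" "singular_map (x - h) \<le> cumul n (k - 1)"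
    using hn k by (auto simp del: cumul.simps intro!: le ge)
  have eqs: "cumul n (k + 1) = cumul n k + mass n k"
    "cumul n (k + 2) = cumul n (k + 1) + mass n (k + 1)"
    "cumul n (k + 3) = cumul n (k + 2) + mass n (k + 2)"
    "cumul n (k + 4) = cumul n (k + 3) + mass n (k + 3)"
    "cumul n (k + 5) = cumul n (k + 4) + mass n (k + 4)"
    "cumul n k = cumul n (k - 1) + mass n (k - 1)"
    "cumul n (k - 1) = cumul n (k - 2) + mass n (k - 2)"
    "cumul n (k - 2) = cumul n (k - 3) + mass n (k - 3)"
    "cumul n (k - 3) = cumul n (k - 4) + mass n (k - 4)"
    using cumul_succ[of n k] cumul_succ[of n "k + 1"] cumul_succ[of n "k + 2"]
      cumul_succ[of n "k + 3"] cumul_succ[of n "k + 4"] cumul_succ[of n "k - 1"]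
      cumul_succ[of n "k - 2"] cumul_succ[of n "k - 3"] cumul_succ[of n "k - 4"]
    by (simp_all add: add.assoc)
  have adj: "mass n (k + 1) \<le> 2 * mass n k" "mass n k \<le> 2 * mass n (k + 1)"
    "mass n (k + 2) \<le> 2 * mass n (k + 1)" "mass n (k + 3) \<le> 2 * mass n (k + 2)"
    "mass n (k + 4) \<le> 2 * mass n (k + 3)"
    "mass n (k - 1) \<le> 2 * mass n k" "mass n k \<le> 2 * mass n (k - 1)"
    "mass n (k - 2) \<le> 2 * mass n (k - 1)" "mass n (k - 3) \<le> 2 * mass n (k - 2)"
    "mass n (k - 4) \<le> 2 * mass n (k - 3)"
    using mass_adjacent[of n k] mass_adjacent[of n "k + 1"] mass_adjacent[of n "k + 2"]
      mass_adjacent[of n "k + 3"] mass_adjacent[of n "k - 1"] mass_adjacent[of n "k - 2"]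
      mass_adjacent[of n "k - 3"] mass_adjacent[of n "k - 4"]
    by (simp_all add: add.assoc)
  show ?thesis
  proof (intro exI[of _ "mass n k / 2"] conjI)
    show "mass n k / 2 > 0" using mass_pos by simp
    show "singular_map (x + h) - singular_map x \<in> {mass n k / 2..62 * (mass n k / 2)}"
      using up eqs adj unfolding atLeastAtMost_iff by linarith
    show "singular_map x - singular_map (x - h) \<in> {mass n k / 2..62 * (mass n k / 2)}"
      using up eqs adj unfolding atLeastAtMost_iff by linarith
  qed
next
  case False
  have near: "y - 1 \<le> singular_map y \<and> singular_map y \<le> y + 1" for y
  proof -
    have "singular_map (of_int \<lfloor>y\<rfloor>) \<le> singular_map y" "singular_map y \<le> singular_map (of_int (\<lfloor>y\<rfloor> + 1))"
      by (auto intro!: monoD[OF mono_singular_map])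
    then show ?thesis
      using singular_map_dyadic[of "\<lfloor>y\<rfloor>" 0] singular_map_dyadic[of "\<lfloor>y\<rfloor> + 1" 0] by (simp, linarith)
  qed
  show ?thesis
    using near[of "x + h"] near[of x] near[of "x - h"] False by (intro exI[of _ "h / 2"]) auto
qed

lemma quasisymmetric_singular_map: "quasisymmetric singular_map"
proof (rule doubling_imp_quasisymmetric[of _ 62])
  show "strict_mono singular_map"
  proof (rule strict_monoI)
    fix x y :: real assume "x < y"
    then show "singular_map x < singular_map y"
      using singular_map_increments_comparable[of "y - x" x] by auto
  qed
  fix x h :: real assume "0 < h"
  then obtain \<mu> where "singular_map (x + h) - singular_map x \<in> {\<mu>..62 * \<mu>}"
      "singular_map x - singular_map (x - h) \<in> {\<mu>..62 * \<mu>}"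
    using singular_map_increments_comparable by blast
  then show "singular_map (x + h) - singular_map x \<le> 62 * (singular_map x - singular_map (x - h))"
    and "singular_map x - singular_map (x - h) \<le> 62 * (singular_map (x + h) - singular_map x)"
    by auto
qed simp

text \<open>
  The quarters carry \<open>1, 2, 4, 2\<close> ninths of the mass if \<open>j\<close> is even and, mirrored, \<open>2, 4, 2, 1\<close>
  ninths if \<open>j\<close> is odd. In both cases the heavy quarter is in the middle.
\<close>

lemma omega_singular_map:
  "omega singular_map {of_int j / 2 ^ n..of_int (j + 1) / 2 ^ n} \<ge> 1 / 400"
proof -
  define d :: real where "d = 1 / 2 ^ (n + 2)"
  have d: "d > 0" by (simp add: d_def)
  have step: "singular_map (of_int k / 2 ^ (n + 2) + d) - singular_map (of_int k / 2 ^ (n + 2))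
      = mass (n + 2) k" for k
  proof -
    have "of_int k / 2 ^ (n + 2) + d = of_int (k + 1) / 2 ^ (n + 2)"
      by (simp add: d_def add_divide_distrib)
    then show ?thesis by (simp only: singular_map_dyadic cumul_succ)
  qed
  define l :: real where "l = of_int j / 2 ^ n"
  have pos: "of_int (4 * j + i) / 2 ^ (n + 2) = l + of_int i * d" for i
    by (simp add: l_def d_def add_divide_distrib power_add)
  have "omega singular_map {l..l + 4 * d} \<ge> 1 / 400"
  proof (cases "even j")
    case True
    have m: "mass (n + 2) (4 * j + 0) = mass n j / 9" "mass (n + 2) (4 * j + 2) = 4 * mass n j / 9"
      using True by simp_all
    then have "4 * (singular_map (l + d) - singular_map l) \<le> singular_map (l + 2 * d + d) - singular_map (l + 2 * d)"
      using step[of "4 * j + 0", unfolded pos m] step[of "4 * j + 2", unfolded pos m] by simp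
    then show ?thesis using d by (intro omega_lower_bound[OF mono_singular_map, of d l l "l + 2 * d"]) auto
  next
    case False
    have "(4 * j + 3) div 2 = 2 * j + 1" "(4 * j + 1) div 2 = 2 * j" by presburger+
    then have m: "mass (n + 2) (4 * j + 3) = mass n j / 9" "mass (n + 2) (4 * j + 1) = 4 * mass n j / 9"
      using False by simp_all
    then have "4 * (singular_map (l + 3 * d + d) - singular_map (l + 3 * d)) \<le> singular_map (l + d + d) - singular_map (l + d)"
      using step[of "4 * j + 3", unfolded pos m] step[of "4 * j + 1", unfolded pos m] by simp
    then show ?thesis
      using d by (intro omega_lower_bound[OF mono_singular_map, of d l "l + 3 * d" "l + d"]) auto
  qed
  moreover have "l + 4 * d = of_int (j + 1) / 2 ^ n"
    by (simp add: l_def d_def add_divide_distrib power_add)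
  ultimately show ?thesis by (simp add: l_def)
qed

theorem proposition2p3:
  "\<exists>(f :: real \<Rightarrow> real) (c :: real).
     quasisymmetric f \<and> c > 0 \<and>
     (\<forall>Q \<in> dyadic_intervals. measure lborel Q \<le> 1 \<longrightarrow> omega f Q \<ge> c)"
proof (intro exI conjI ballI impI)
  show "quasisymmetric singular_map" by (rule quasisymmetric_singular_map)
  show "(0 :: real) < 1 / 400" by simp
  fix Q assume "Q \<in> dyadic_intervals" and small: "measure lborel Q \<le> 1"
  then obtain n j :: int where Q: "Q = {2 powi n * of_int j..2 powi n * (of_int j + 1)}"
    by (auto simp: dyadic_intervals_def)
  have "measure lborel Q = 2 powi n" unfolding Q by (simp add: algebra_simps)
  then have "n \<le> 0" using small one_less_power_int[of "2 :: real" n] by fastforce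
  then obtain N where "n = - int N" using nonpos_int_cases by blast
  then have "Q = {of_int j / 2 ^ N..of_int (j + 1) / 2 ^ N}"
    unfolding Q by (simp add: power_int_minus field_simps)
  then show "1 / 400 \<le> omega singular_map Q" using omega_singular_map by simp
qed

end
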